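(* Let $\mathbf e\in\mathbb{R}^3$ be a unit vector and let $SO(2)$ be the group of rotations of $\mathbb{R}^3$ about $\mathbf e$. If the angular momentum is $J=j\,\mathbf e$ with $j\in\mathbb{R}$ (that is, $J(t)=j(t)\,\mathbf e$ along a motion, with $j$ a real-valued function of $t$), then $\sigma^{-1}_{\mathbf e}(J)+\sigma^{-1}_{\mathbf n}(J)$ depends only on the class of $q$ in $\Sigma/SO(2)$. Explicitly: let $q\in\Sigma\setminus\{0\}$ be a configuration with unit normal vector $\mathbf n\neq\pm\mathbf e$, let $J=j\,\mathbf e$ be an admissible angular momentum at $q$, and let $R\in SO(2)$. Then the quantity $\sigma^{-1}_{\mathbf e}(J)+\sigma^{-1}_{\mathbf n}(J)$ computed from $(q,\mathbf n)$ equals the same quantity computed, with the same $J$, from $(Rq,R\mathbf n)$.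
   Context: Masses $m_1,m_2,m_3>0$; $\Sigma=\{q=(q_1,q_2,q_3)\in(\mathbb{R}^3)^3:\sum_i m_iq_i=0\}$, on which rotations act diagonally; moment of inertia $I=\sum_i m_i|q_i|^2$. A unit normal vector of $q$ is a unit vector $\mathbf n$ orthogonal to $q_1,q_2,q_3$. For a configuration $q$, $\sigma=\sigma_q:\mathbb{R}^3\to\mathbb{R}^3$, $\sigma(a)=\sum_i m_i\,q_i\times(a\times q_i)$, sends an angular velocity vector $a\in Lie(SO(3))\cong\mathbb{R}^3$ to the angular momentum of the corresponding rigid rotation of $q$; admissible angular momenta at $q$ are the elements of the image of $\sigma_q$. If $q$ is not collinear, $\sigma$ is an isomorphism; if $q$ is collinear, one sets $\sigma^{-1}(J):=J/I$. When $\mathbf n\neq\pm\mathbf e$, the vectors $\mathbf e,\mathbf n,\mathbf e\wedge\mathbf n$ ($\wedge$ the cross product) form a basis of $\mathbb{R}^3$, and $\sigma^{-1}_{\mathbf e}(J),\sigma^{-1}_{\mathbf n}(J),\sigma^{-1}_{\wedge}(J)$ are the coefficients in $\sigma^{-1}(J)=\sigma^{-1}_{\mathbf e}(J)\,\mathbf e+\sigma^{-1}_{\mathbf n}(J)\,\mathbf n+\sigma^{-1}_{\wedge}(J)\,\mathbf e\wedge\mathbf n$. *)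

theory Defs
  imports "HOL-Analysis.Analysis"
begin

unbundle cross3_syntax

text \<open>Row \<open>q $ i\<close> is the position of the \<open>i\<close>-th body.\<close>

type_synonym config = "(real^3)^3"

definition centred_configs :: "real^3 \<Rightarrow> config set" where
  "centred_configs m = {q. (\<Sum>i\<in>UNIV. m $ i *\<^sub>R q $ i) = 0}"

definition rotate_config :: "real^3^3 \<Rightarrow> config \<Rightarrow> config" where
  "rotate_config R q = (\<chi> i. R *v (q $ i))"

definition moment_of_inertia :: "real^3 \<Rightarrow> config \<Rightarrow> real" where
  "moment_of_inertia m q = (\<Sum>i\<in>UNIV. m $ i * (norm (q $ i))\<^sup>2)"

definition unit_normal :: "config \<Rightarrow> real^3 \<Rightarrow> bool" where
  "unit_normal q n \<longleftrightarrow> norm n = 1 \<and> (\<forall>i. orthogonal n (q $ i))"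

definition sigma :: "real^3 \<Rightarrow> config \<Rightarrow> real^3 \<Rightarrow> real^3" where
  "sigma m q a = (\<Sum>i\<in>UNIV. m $ i *\<^sub>R (q $ i \<times> (a \<times> q $ i)))"

definition admissible :: "real^3 \<Rightarrow> config \<Rightarrow> real^3 \<Rightarrow> bool" where
  "admissible m q J \<longleftrightarrow> J \<in> range (sigma m q)"

text \<open>For a collinear configuration \<open>sigma m q\<close> is not invertible, and \<open>J / I\<close> is used by
  convention. Collinearity is that of the three positions; when the centre of mass is at the
  origin, the line containing them passes through the origin.\<close>

definition sigma_inv :: "real^3 \<Rightarrow> config \<Rightarrow> real^3 \<Rightarrow> real^3" where
  "sigma_inv m q J =
     (if collinear (range (\<lambda>i. q $ i)) then J /\<^sub>R moment_of_inertia m q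
      else inv (sigma m q) J)"

text \<open>Coefficients of \<open>sigma_inv m q J\<close> on \<open>e\<close> and on \<open>n\<close> in the basis
  \<open>e, n, e \<times> n\<close>; meaningful for unit vectors with \<open>n \<noteq> e\<close> and \<open>n \<noteq> - e\<close>.\<close>

definition sigma_inv_e :: "real^3 \<Rightarrow> real^3 \<Rightarrow> config \<Rightarrow> real^3 \<Rightarrow> real^3 \<Rightarrow> real" where
  "sigma_inv_e m e q n J = representation {e, n, e \<times> n} (sigma_inv m q J) e"

definition sigma_inv_n :: "real^3 \<Rightarrow> real^3 \<Rightarrow> config \<Rightarrow> real^3 \<Rightarrow> real^3 \<Rightarrow> real" where
  "sigma_inv_n m e q n J = representation {e, n, e \<times> n} (sigma_inv m q J) n"

definition rotations_about :: "real^3 \<Rightarrow> (real^3^3) set" where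
  "rotations_about e = {R. rotation_matrix R \<and> R *v e = e}"

end

theory Submission
  imports Defs
begin

text \<open>
  Every ingredient of the statement is built from the vector space structure, the inner product
  and the cross product of \<open>\<real>\<^sup>3\<close>, and a rotation \<open>R\<close> preserves all three. Hence
  \<open>sigma\<close> is equivariant: \<open>\<sigma>\<^bsub>Rq\<^esub>(R a) = R \<sigma>\<^bsub>q\<^esub>(a)\<close>. Since \<open>R\<close> fixes \<open>e\<close>, it fixes
  \<open>J = j e\<close>, so \<open>\<sigma>\<^bsub>Rq\<^esub>\<^sup>-\<^sup>1(J) = R \<sigma>\<^bsub>q\<^esub>\<^sup>-\<^sup>1(J)\<close>. On collinear
  configurations this holds because \<open>J / I\<close> is rotated along with \<open>J\<close>. Otherwise it needs
  \<open>\<sigma>\<^bsub>q\<^esub>\<close> to be injective, which comes from the positivity of twice the kinetic energy,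
  \<open>a \<bullet> \<sigma>\<^bsub>q\<^esub>(a) = \<Sum>\<^sub>i m\<^sub>i |a \<times> q\<^sub>i|\<^sup>2\<close> (lemma \<open>inj_sigma\<close>). Finally
  \<open>R\<close> carries the basis \<open>e, n, e \<times> n\<close> to \<open>e, Rn, e \<times> Rn\<close>, and coordinates do not change when a
  vector and the basis are moved by the same injective linear map
  (lemma \<open>representation_image\<close>). So even the two coefficients are separately invariant.
\<close>

text \<open>A vector and its family move together, so the expansion is carried over term by term; for
  the same reason the default value 0, taken when \<open>B\<close> is dependent or its span misses \<open>v\<close>, occurs
  on both sides at once.\<close>

lemma representation_image:
  fixes f :: "'a::real_vector \<Rightarrow> 'b::real_vector"
  assumes "linear f" and "inj f"
  shows "representation (f ` B) (f v) (f b) = representation B v b"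
proof -
  have indep: "independent (f ` B) \<longleftrightarrow> independent B"
  proof
    assume "independent B"
    then show "independent (f ` B)"
      using linear_independent_injective_image[OF \<open>linear f\<close>] inj_on_subset[OF \<open>inj f\<close>] by auto
  next
    assume "independent (f ` B)"
    obtain g where "linear g" and g: "g \<circ> f = id"
      using linear_injective_left_inverse[OF assms] by blast
    have "inj_on g (span (f ` B))"
      using g by (auto simp: linear_span_image[OF \<open>linear f\<close>] inj_on_def pointfree_idE)
    then have "independent (g ` f ` B)"
      using linear_independent_injective_image[OF \<open>linear g\<close> \<open>independent (f ` B)\<close>] by simp
    then show "independent B"
      using g by (simp add: image_comp)
  qed
  show ?thesis
  proof (cases "independent B \<and> v \<in> span B")
    case True
    define c where "c = representation B v"
    define d where "d = (\<lambda>y. if y \<in> range f then c (inv f y) else 0)"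
    have d_f: "d (f x) = c x" for x
      using \<open>inj f\<close> by (simp add: d_def)
    have supp: "{y. d y \<noteq> 0} = f ` {x. c x \<noteq> 0}"
    proof (intro equalityI subsetI)
      fix y
      assume "y \<in> {y. d y \<noteq> 0}"
      then have "y \<in> range f" "d y \<noteq> 0"
        by (auto simp: d_def split: if_splits)
      then show "y \<in> f ` {x. c x \<noteq> 0}"
        using d_f by auto
    next
      fix y
      assume "y \<in> f ` {x. c x \<noteq> 0}"
      then show "y \<in> {y. d y \<noteq> 0}"
        using d_f by auto
    qed
    have "representation (f ` B) (f v) = d"
    proof (rule representation_eqI)
      show "independent (f ` B)"
        using True indep by simp
      show "f v \<in> span (f ` B)"
        using True by (simp add: linear_span_image[OF \<open>linear f\<close>])
      show "y \<in> f ` B" if "d y \<noteq> 0" for y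
        using that supp unfolding c_def by (blast dest: representation_ne_zero)
      show "finite {y. d y \<noteq> 0}"
        unfolding supp c_def by (intro finite_imageI finite_representation)
      have "(\<Sum>y | d y \<noteq> 0. d y *\<^sub>R y) = (\<Sum>x | c x \<noteq> 0. c x *\<^sub>R f x)"
        unfolding supp using \<open>inj f\<close>
        by (subst sum.reindex) (auto simp: d_f intro: inj_on_subset)
      also have "\<dots> = f (\<Sum>x | c x \<noteq> 0. c x *\<^sub>R x)"
        by (simp add: linear_sum[OF \<open>linear f\<close>] linear_scale[OF \<open>linear f\<close>])
      also have "\<dots> = f v"
        using True by (simp add: c_def sum_nonzero_representation_eq)
      finally show "(\<Sum>y | d y \<noteq> 0. d y *\<^sub>R y) = f v" .
    qed
    then show ?thesis
      by (simp add: d_f c_def)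
  next
    case False
    have "f v \<in> span (f ` B) \<longleftrightarrow> v \<in> span B"
      using \<open>inj f\<close> by (simp add: linear_span_image[OF \<open>linear f\<close>] inj_image_mem_iff)
    then show ?thesis
      using False indep by (auto simp: representation_def)
  qed
qed

lemma orthogonal_transformation_rotation_matrix:
  fixes R :: "real^'n^'n"
  assumes "rotation_matrix R"
  shows "orthogonal_transformation ((*v) R)"
  using assms by (simp add: rotation_matrix_def orthogonal_transformation_matrix)

lemma inner_rotation_matrix:
  fixes R :: "real^'n^'n"
  assumes "rotation_matrix R"
  shows "(R *v x) \<bullet> (R *v y) = x \<bullet> y"
  using orthogonal_transformation_rotation_matrix[OF assms]
  by (simp add: orthogonal_transformation_def)

lemmas norm_rotation_matrix =
  orthogonal_transformation_norm[OF orthogonal_transformation_rotation_matrix]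

lemmas inj_rotation_matrix =
  orthogonal_transformation_inj[OF orthogonal_transformation_rotation_matrix]

lemma linear_sigma: "linear (sigma m q)"
  unfolding sigma_def
  by (intro linearI)
    (simp_all add: cross_add_left cross_add_right cross_mult_left cross_mult_right
      scaleR_add_right sum.distrib scaleR_sum_right mult.commute)

lemma inner_sigma:
  "a \<bullet> sigma m q a = (\<Sum>i\<in>UNIV. m $ i * (norm (a \<times> q $ i))\<^sup>2)"
proof -
  have "a \<bullet> (x \<times> (a \<times> x)) = (norm (a \<times> x))\<^sup>2" for x
    by (simp add: cross_triple[of a] power2_norm_eq_inner inner_commute)
  then show ?thesis
    by (simp add: sigma_def inner_sum_right)
qed

text \<open>If the rotation with angular velocity \<open>a \<noteq> 0\<close> carries no angular momentum, it carries no
  kinetic energy either, so every body sits on its axis.\<close>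

lemma inj_sigma:
  assumes "\<forall>i. m $ i > 0" and "\<not> collinear (range (\<lambda>i. q $ i))"
  shows "inj (sigma m q)"
proof (subst linear_injective_0[OF linear_sigma], intro allI impI)
  fix a
  assume "sigma m q a = 0"
  then have "(\<Sum>i\<in>UNIV. m $ i * (norm (a \<times> q $ i))\<^sup>2) = 0"
    by (simp flip: inner_sigma)
  moreover have "\<forall>i. m $ i * (norm (a \<times> q $ i))\<^sup>2 \<ge> 0"
    using assms(1) by (simp add: less_imp_le)
  ultimately have "\<forall>i. m $ i * (norm (a \<times> q $ i))\<^sup>2 = 0"
    by (subst (asm) sum_nonneg_eq_0_iff) auto
  then have cross: "a \<times> q $ i = 0" for i
    using assms(1) by (metis less_irrefl mult_eq_0_iff norm_eq_zero zero_eq_power2)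
  show "a = 0"
  proof (rule ccontr)
    assume "a \<noteq> 0"
    then have "\<exists>c. q $ i = c *\<^sub>R a" for i
      using cross[of i] by (auto simp: cross_eq_0 collinear_lemma intro: exI[of _ 0])
    then have "\<forall>x\<in>range (\<lambda>i. q $ i). \<exists>c. x = 0 + c *\<^sub>R a"
      by auto
    then have "collinear (range (\<lambda>i. q $ i))"
      unfolding collinear_alt by blast
    with assms(2) show False ..
  qed
qed

lemma sigma_rotate:
  assumes "rotation_matrix R"
  shows "sigma m (rotate_config R q) (R *v a) = R *v sigma m q a"
  by (simp add: sigma_def rotate_config_def cross_rotation_matrix[OF assms]
      matrix_vector_mult_scaleR linear_sum[OF matrix_vector_mul_linear])

lemma moment_of_inertia_rotate:
  assumes "rotation_matrix R"
  shows "moment_of_inertia m (rotate_config R q) = moment_of_inertia m q"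
  by (simp add: moment_of_inertia_def rotate_config_def norm_rotation_matrix[OF assms])

lemma collinear_rotate_iff:
  assumes "rotation_matrix R"
  shows "collinear (range (\<lambda>i. rotate_config R q $ i)) \<longleftrightarrow> collinear (range (\<lambda>i. q $ i))"
proof -
  have "range (\<lambda>i. rotate_config R q $ i) = ((*v) R) ` range (\<lambda>i. q $ i)"
    by (auto simp: rotate_config_def)
  then show ?thesis
    using inj_rotation_matrix[OF assms]
    by (simp add: collinear_aff_dim aff_dim_injective_linear_image)
qed

text \<open>Since \<open>J\<close> is admissible, in the noncollinear case \<open>inv (sigma m q) J\<close> is a genuine preimage of \<open>J\<close>
  and injectivity of \<open>sigma\<close> at the rotated configuration identifies its image.\<close>

lemma sigma_inv_rotate:
  assumes "\<forall>i. m $ i > 0" and R: "rotation_matrix R" and "admissible m q J"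
  shows "sigma_inv m (rotate_config R q) (R *v J) = R *v sigma_inv m q J"
proof (cases "collinear (range (\<lambda>i. q $ i))")
  case True
  then show ?thesis
    by (simp add: sigma_inv_def collinear_rotate_iff[OF R] moment_of_inertia_rotate[OF R]
        matrix_vector_mult_scaleR)
next
  case False
  then have "\<not> collinear (range (\<lambda>i. rotate_config R q $ i))"
    by (simp add: collinear_rotate_iff[OF R])
  moreover have "sigma m (rotate_config R q) (R *v inv (sigma m q) J) = R *v J"
    using assms(3) by (simp add: sigma_rotate[OF R] admissible_def f_inv_into_f)
  ultimately show ?thesis
    using False inj_sigma[OF assms(1)] by (simp add: sigma_inv_def inv_f_eq)
qed

lemma representation_rotate:
  assumes R: "rotation_matrix R" and "R *v e = e"
  shows "representation {e, R *v n, e \<times> (R *v n)} (R *v v) (R *v b)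
    = representation {e, n, e \<times> n} v b"
proof -
  have "(*v) R ` {e, n, e \<times> n} = {e, R *v n, e \<times> (R *v n)}"
    using cross_rotation_matrix[OF R, of e n] assms(2) by simp
  then show ?thesis
    using representation_image[OF matrix_vector_mul_linear inj_rotation_matrix[OF R]] by metis
qed

theorem proposition5p1:
  fixes m e n :: "real^3" and q :: config and j :: real and R :: "real^3^3"
  assumes "\<forall>i. m $ i > 0"
    and "norm e = 1"
    and "q \<in> centred_configs m - {0}"
    and "unit_normal q n" and "n \<noteq> e" and "n \<noteq> - e"
    and "admissible m q (j *\<^sub>R e)"
    and "R \<in> rotations_about e"
  shows "rotate_config R q \<in> centred_configs m - {0}
    \<and> unit_normal (rotate_config R q) (R *v n) \<and> R *v n \<noteq> e \<and> R *v n \<noteq> - e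
    \<and> admissible m (rotate_config R q) (j *\<^sub>R e)
    \<and> sigma_inv_e m e q n (j *\<^sub>R e) + sigma_inv_n m e q n (j *\<^sub>R e)
      = sigma_inv_e m e (rotate_config R q) (R *v n) (j *\<^sub>R e)
        + sigma_inv_n m e (rotate_config R q) (R *v n) (j *\<^sub>R e)"
proof (intro conjI)
  have R: "rotation_matrix R" and Re: "R *v e = e"
    using assms(8) by (auto simp: rotations_about_def)
  note injR = inj_rotation_matrix[OF R]
  have RJ: "R *v (j *\<^sub>R e) = j *\<^sub>R e"
    by (simp add: matrix_vector_mult_scaleR Re)
  have "(\<Sum>i\<in>UNIV. m $ i *\<^sub>R rotate_config R q $ i) = R *v (\<Sum>i\<in>UNIV. m $ i *\<^sub>R q $ i)"
    by (simp add: rotate_config_def linear_sum[OF matrix_vector_mul_linear]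
        matrix_vector_mult_scaleR)
  moreover have "rotate_config R q \<noteq> 0"
  proof
    assume "rotate_config R q = 0"
    then have "norm (R *v (q $ i)) = 0" for i
      by (simp add: rotate_config_def vec_eq_iff)
    then have "q = 0"
      unfolding norm_rotation_matrix[OF R] by (simp add: vec_eq_iff)
    with assms(3) show False by simp
  qed
  ultimately show "rotate_config R q \<in> centred_configs m - {0}"
    using assms(3) by (simp add: centred_configs_def)
  show "unit_normal (rotate_config R q) (R *v n)"
    using assms(4) by (simp add: unit_normal_def rotate_config_def orthogonal_def
        norm_rotation_matrix[OF R]
        inner_rotation_matrix[OF R])
  show "R *v n \<noteq> e"
    using assms(5) injD[OF injR, of n e] Re by auto
  have "R *v (- e) = - e"
    using Re by (simp add: linear_neg[OF matrix_vector_mul_linear])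
  then show "R *v n \<noteq> - e"
    using assms(6) injD[OF injR, of n "- e"] by auto
  show "admissible m (rotate_config R q) (j *\<^sub>R e)"
    using assms(7) sigma_rotate[OF R] RJ by (metis admissible_def rangeE rangeI)
  have inv: "sigma_inv m (rotate_config R q) (j *\<^sub>R e) = R *v sigma_inv m q (j *\<^sub>R e)"
    using sigma_inv_rotate[OF assms(1) R assms(7)] RJ by simp
  have "sigma_inv_e m e (rotate_config R q) (R *v n) (j *\<^sub>R e) = sigma_inv_e m e q n (j *\<^sub>R e)"
    using representation_rotate[OF R Re, of n _ e] by (simp add: sigma_inv_e_def inv Re)
  moreover
  have "sigma_inv_n m e (rotate_config R q) (R *v n) (j *\<^sub>R e) = sigma_inv_n m e q n (j *\<^sub>R e)"
    using representation_rotate[OF R Re, of n _ n] by (simp add: sigma_inv_n_def inv)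
  ultimately show "sigma_inv_e m e q n (j *\<^sub>R e) + sigma_inv_n m e q n (j *\<^sub>R e)
      = sigma_inv_e m e (rotate_config R q) (R *v n) (j *\<^sub>R e)
        + sigma_inv_n m e (rotate_config R q) (R *v n) (j *\<^sub>R e)"
    by simp
qed

end
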